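(* Let $\{(w^k,\lambda^k,\zeta^k,\eta^k)\}_{k\ge1}\subseteq\mathbb{R}^n\times\mathbb{R}^r\times\mathbb{R}^n\times\mathbb{R}^r$ be an infinite sequence generated by the smoothing algorithm described in the context. Suppose that: (A1) $\liminf_{k\to\infty}\lambda_1^k>0$; (A2) the sequence $\{(w^k,\lambda^k,\zeta^k,\eta^k)\}$ is bounded; (A3) if $p=1$, then for every accumulation point $(w^*,\lambda^* )$ of $\{(w^k,\lambda^k)\}$ and every $i\in I(w^* )$ one has $\lambda_1^*\ne\left|\frac{\partial G(w^*,\bar\lambda^* )}{\partial w_i}\right|$. Then any accumulation point $(w^*,\lambda^*,\zeta^*,\eta^* )$ of $\{(w^k,\lambda^k,\zeta^k,\eta^k)\}$ satisfies the following (SB-KKT) conditions, with $W_*:=\mathrm{diag}(w^* )$: $$W_*^2\nabla f(w^* )+H(w^*,\lambda^* )\zeta^*=0,$$ $$W_*\nabla_wG(w^*,\bar\lambda^* )+p\lambda_1^*|w^*|^p=0,$$ $$p\sum_{i\notin I(w^* )}\mathrm{sgn}(w_i^* )|w_i^*|^{p-1}\zeta_i^*=\eta_1^*,$$ $$\zeta_i^*=0\quad(i\in I(w^* )),$$ $$\nabla R_i(w^* )^\top\zeta^*=\eta_i^*\quad(i=2,\ldots,r),$$ $$0\le\lambda^*,\quad 0\le\eta^*,\quad(\lambda^* )^\top\eta^*=0 .$$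
   Context: Setting: $n,r\ge1$ are integers and $0<p\le1$; $f:\mathbb{R}^n\to\mathbb{R}$ is continuously differentiable; $g,R_2,\ldots,R_r:\mathbb{R}^n\to\mathbb{R}$ are twice continuously differentiable. For $\lambda=(\lambda_1,\ldots,\lambda_r)^\top\in\mathbb{R}^r$ write $\bar\lambda:=(\lambda_2,\ldots,\lambda_r)^\top$ and $G(w,\bar\lambda):=g(w)+\sum_{i=2}^r\lambda_iR_i(w)$. Vector inequalities are componentwise. For $w\in\mathbb{R}^n$: $I(w):=\{i\in\{1,\ldots,n\}: w_i=0\}$, $|w|^p:=(|w_1|^p,\ldots,|w_n|^p)^\top$, $\mathrm{sgn}$ is the sign function, $\mathrm{diag}(v)$ is the diagonal matrix with diagonal $v$, and "$i\notin I(w)$" means $i\in\{1,\ldots,n\}\setminus I(w)$. Put $H(w,\lambda):=W^2\nabla^2_{ww}G(w,\bar\lambda)+\lambda_1p(p-1)\,\mathrm{diag}(|w|^p)$ with $W=\mathrm{diag}(w)$. Smoothing function: for $\mu\neq0$, $\varphi_\mu(w):=\sum_{i=1}^n(w_i^2+\mu^2)^{p/2}$. For $\hat\varepsilon\ge0$ and $\mu\ne0$, $(w,\lambda,\zeta,\eta)\in\mathbb{R}^n\times\mathbb{R}^r\times\mathbb{R}^n\times\mathbb{R}^r$ is an $\hat\varepsilon$-approximate KKT point for the smoothed problem with parameter $\mu$ (minimize $f(w)$ subject to $\nabla_wG(w,\bar\lambda)+\lambda_1\nabla\varphi_\mu(w)=0$, $\lambda\ge0$) if there is $(\varepsilon_1,\varepsilon_2,\varepsilon_3,\varepsilon_4,\varepsilon_5)\in\mathbb{R}^n\times\mathbb{R}\times\mathbb{R}^{r-1}\times\mathbb{R}^n\times\mathbb{R}$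 of Euclidean norm at most $\hat\varepsilon$ such that $\nabla f(w)+(\nabla^2_{ww}G(w,\bar\lambda)+\lambda_1\nabla^2\varphi_\mu(w))\zeta=\varepsilon_1$; $\nabla\varphi_\mu(w)^\top\zeta-\eta_1=\varepsilon_2$; $\nabla R_i(w)^\top\zeta-\eta_i=(\varepsilon_3)_i$ for $i=2,\ldots,r$ (components of $\varepsilon_3$ are indexed by $2,\ldots,r$); $\nabla_wG(w,\bar\lambda)+\lambda_1\nabla\varphi_\mu(w)=\varepsilon_4$; $0\le\lambda$, $0\le\eta$, $\lambda^\top\eta=\varepsilon_5$. Smoothing algorithm: choose $\mu_0\ne0$, $\beta_1,\beta_2\in(0,1)$, $\hat\varepsilon_0\ge0$. For $k=0,1,2,\ldots$: let $(w^{k+1},\lambda^{k+1},\zeta^{k+1},\eta^{k+1})$ be an $\hat\varepsilon_k$-approximate KKT point for the smoothed problem with $\mu=\mu_k$; set $\mu_{k+1}=\beta_1\mu_k$, $\hat\varepsilon_{k+1}=\beta_2\hat\varepsilon_k$. It is assumed that such a point is found at every iteration and that infinitely many iterates are generated. *)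

theory Defs
  imports "HOL-Analysis.Analysis"
begin

definition gradient :: "(real^'n \<Rightarrow> real) \<Rightarrow> real^'n \<Rightarrow> real^'n" where
  "gradient f w = (\<chi> i. frechet_derivative f (at w) (axis i 1))"

lemma gderiv_gradient:
  assumes "f differentiable (at w)"
  shows "GDERIV f w :> gradient f w"
proof -
  let ?D = "frechet_derivative f (at w)"
  have D: "(f has_derivative ?D) (at w)"
    using assms by (simp add: frechet_derivative_works)
  then have lin: "linear ?D"
    by (rule has_derivative_linear)
  have "?D h = h \<bullet> gradient f w" for h
  proof -
    have "?D h = ?D (\<Sum>i\<in>UNIV. h $ i *\<^sub>R axis i 1)"
      by (metis (no_types) basis_expansion scalar_mult_eq_scaleR)
    also have "\<dots> = (\<Sum>i\<in>UNIV. h $ i * ?D (axis i 1))"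
      by (simp add: linear_sum[OF lin] linear_scale[OF lin])
    also have "\<dots> = h \<bullet> gradient f w"
      by (simp add: inner_vec_def gradient_def)
    finally show ?thesis .
  qed
  then have "?D = (\<lambda>h. h \<bullet> gradient f w)"
    by blast
  with D show ?thesis
    by (simp add: gderiv_def)
qed

definition hessian :: "(real^'n \<Rightarrow> real) \<Rightarrow> real^'n \<Rightarrow> real^'n^'n" where
  "hessian f w = jacobian (gradient f) (at w)"

definition cont_diff :: "(real^'n \<Rightarrow> real) \<Rightarrow> bool" where
  "cont_diff f \<longleftrightarrow> (\<forall>w. f differentiable (at w)) \<and> continuous_on UNIV (gradient f)"

definition twice_cont_diff :: "(real^'n \<Rightarrow> real) \<Rightarrow> bool" where
  "twice_cont_diff f \<longleftrightarrow> (\<forall>w. f differentiable (at w)) \<and>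
     (\<forall>w. gradient f differentiable (at w)) \<and> continuous_on UNIV (hessian f)"

text \<open>Limits of subsequences; this differs from limit points of the range of the sequence
  when values are repeated.\<close>

definition accumulation_point :: "(nat \<Rightarrow> 'a::topological_space) \<Rightarrow> 'a \<Rightarrow> bool" where
  "accumulation_point X l \<longleftrightarrow> (\<exists>s. strict_mono s \<and> (X \<circ> s) \<longlonglongrightarrow> l)"

definition zero_set :: "real^'n \<Rightarrow> 'n set" where
  "zero_set w = {i. w $ i = 0}"

definition abs_powr :: "real^'n \<Rightarrow> real \<Rightarrow> real^'n" where
  "abs_powr w p = (\<chi> i. \<bar>w $ i\<bar> powr p)"

definition diag :: "real^'n \<Rightarrow> real^'n^'n" where
  "diag v = (\<chi> i j. if i = j then v $ i else 0)"

text \<open>The multipliers \<open>(\<lambda>\<^sub>1, \<dots>, \<lambda>\<^sub>r)\<close> are vectors over a finite index type \<open>'r\<close> with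
  \<open>r\<close> elements, and the distinguished index \<open>one :: 'r\<close> plays the role of \<open>1\<close>; the indices
  \<open>2, \<dots>, r\<close> are those different from \<open>one\<close>. The case \<open>r = 1\<close> is a singleton type \<open>'r\<close>. The
  value \<open>R one\<close> is never used.

  The function \<open>G\<close> takes the full vector of multipliers but ignores its component \<open>one\<close>.\<close>

definition G_fun ::
  "'r::finite \<Rightarrow> (real^'n \<Rightarrow> real) \<Rightarrow> ('r \<Rightarrow> real^'n \<Rightarrow> real) \<Rightarrow> real^'r \<Rightarrow> real^'n \<Rightarrow> real" where
  "G_fun one g R lam w = g w + (\<Sum>i\<in>UNIV - {one}. lam $ i * R i w)"

definition H_mat ::
  "'r::finite \<Rightarrow> real \<Rightarrow> (real^'n \<Rightarrow> real) \<Rightarrow> ('r \<Rightarrow> real^'n \<Rightarrow> real) \<Rightarrow>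
    real^'n \<Rightarrow> real^'r \<Rightarrow> real^'n^'n" where
  "H_mat one p g R w lam =
     diag w ** diag w ** hessian (G_fun one g R lam) w
     + (lam $ one * p * (p - 1)) *\<^sub>R diag (abs_powr w p)"

definition smooth_phi :: "real \<Rightarrow> real \<Rightarrow> real^'n \<Rightarrow> real" where
  "smooth_phi p \<mu> w = (\<Sum>i\<in>UNIV. ((w $ i)\<^sup>2 + \<mu>\<^sup>2) powr (p / 2))"

text \<open>An element of \<open>\<real>\<close>-space of dimension \<open>r - 1\<close>, indexed by \<open>2, \<dots>, r\<close>, is represented by
  \<open>\<epsilon>3 :: real^'r\<close> with vanishing component \<open>one\<close>. The norm of a tuple is the Euclidean norm,
  that is, the square root of the sum of the squared norms of the parts. The order on
  \<open>real^'r\<close> is componentwise.\<close>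

definition approx_KKT ::
  "'r::finite \<Rightarrow> real \<Rightarrow> (real^'n \<Rightarrow> real) \<Rightarrow> (real^'n \<Rightarrow> real) \<Rightarrow> ('r \<Rightarrow> real^'n \<Rightarrow> real) \<Rightarrow>
    real \<Rightarrow> real \<Rightarrow> real^'n \<Rightarrow> real^'r \<Rightarrow> real^'n \<Rightarrow> real^'r \<Rightarrow> bool" where
  "approx_KKT one p f g R \<mu> eps w lam \<zeta> \<eta> \<longleftrightarrow>
     (\<exists>(\<epsilon>1 :: real^'n) (\<epsilon>2 :: real) (\<epsilon>3 :: real^'r) (\<epsilon>4 :: real^'n) (\<epsilon>5 :: real).
        \<epsilon>3 $ one = 0 \<and>
        norm (\<epsilon>1, \<epsilon>2, \<epsilon>3, \<epsilon>4, \<epsilon>5) \<le> eps \<and>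
        gradient f w
          + (hessian (G_fun one g R lam) w + lam $ one *\<^sub>R hessian (smooth_phi p \<mu>) w) *v \<zeta> = \<epsilon>1 \<and>
        gradient (smooth_phi p \<mu>) w \<bullet> \<zeta> - \<eta> $ one = \<epsilon>2 \<and>
        (\<forall>i. i \<noteq> one \<longrightarrow> gradient (R i) w \<bullet> \<zeta> - \<eta> $ i = \<epsilon>3 $ i) \<and>
        gradient (G_fun one g R lam) w + lam $ one *\<^sub>R gradient (smooth_phi p \<mu>) w = \<epsilon>4 \<and>
        0 \<le> lam \<and> 0 \<le> \<eta> \<and> lam \<bullet> \<eta> = \<epsilon>5)"

text \<open>Iterates are numbered from \<open>1\<close>; the values of the sequences at \<open>0\<close> are unconstrained.\<close>

definition generated_by_smoothing ::
  "'r::finite \<Rightarrow> real \<Rightarrow> (real^'n \<Rightarrow> real) \<Rightarrow> (real^'n \<Rightarrow> real) \<Rightarrow> ('r \<Rightarrow> real^'n \<Rightarrow> real) \<Rightarrow>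
    (nat \<Rightarrow> real^'n) \<Rightarrow> (nat \<Rightarrow> real^'r) \<Rightarrow> (nat \<Rightarrow> real^'n) \<Rightarrow> (nat \<Rightarrow> real^'r) \<Rightarrow> bool" where
  "generated_by_smoothing one p f g R w lam \<zeta> \<eta> \<longleftrightarrow>
     (\<exists>(\<mu> :: nat \<Rightarrow> real) (eps :: nat \<Rightarrow> real) (\<beta>1 :: real) (\<beta>2 :: real).
        \<mu> 0 \<noteq> 0 \<and> 0 < \<beta>1 \<and> \<beta>1 < 1 \<and> 0 < \<beta>2 \<and> \<beta>2 < 1 \<and> 0 \<le> eps 0 \<and>
        (\<forall>k. approx_KKT one p f g R (\<mu> k) (eps k)
               (w (Suc k)) (lam (Suc k)) (\<zeta> (Suc k)) (\<eta> (Suc k)) \<and>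
             \<mu> (Suc k) = \<beta>1 * \<mu> k \<and> eps (Suc k) = \<beta>2 * eps k))"

definition SB_KKT ::
  "'r::finite \<Rightarrow> real \<Rightarrow> (real^'n \<Rightarrow> real) \<Rightarrow> (real^'n \<Rightarrow> real) \<Rightarrow> ('r \<Rightarrow> real^'n \<Rightarrow> real) \<Rightarrow>
    real^'n \<Rightarrow> real^'r \<Rightarrow> real^'n \<Rightarrow> real^'r \<Rightarrow> bool" where
  "SB_KKT one p f g R w lam \<zeta> \<eta> \<longleftrightarrow>
     (diag w ** diag w) *v gradient f w + H_mat one p g R w lam *v \<zeta> = 0 \<and>
     diag w *v gradient (G_fun one g R lam) w + (p * lam $ one) *\<^sub>R abs_powr w p = 0 \<and>
     p * (\<Sum>i\<in>UNIV - zero_set w. sgn (w $ i) * \<bar>w $ i\<bar> powr (p - 1) * \<zeta> $ i) = \<eta> $ one \<and>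
     (\<forall>i\<in>zero_set w. \<zeta> $ i = 0) \<and>
     (\<forall>i. i \<noteq> one \<longrightarrow> gradient (R i) w \<bullet> \<zeta> = \<eta> $ i) \<and>
     0 \<le> lam \<and> 0 \<le> \<eta> \<and> lam \<bullet> \<eta> = 0"

end

theory Submission
  imports Defs
begin

text \<open>Along a subsequence converging to the accumulation point, the smoothing parameter and
  the tolerance tend to 0, while the gradients and Hessians of \<open>f\<close>,
  \<open>G_fun\<close> and the \<open>R i\<close> converge by continuity. Since
  \<open>smooth_phi\<close> is separable, the remaining terms can be studied one coordinate at a
  time, through the first and second derivatives of
  \<open>(x\<^sup>2 + \<mu>\<^sup>2) powr (p / 2)\<close>.

  By (A1) the limit of lambda_1 is positive. Hence the stationarity residual forces each smoothed
  first derivative to converge, to -(dG/dw_i)/lambda_1, and the first residual forces each product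
  of a smoothed second derivative with \<open>\<zeta>_i\<close> to converge. If \<open>w'_i\<close>
  is nonzero, these derivatives tend to those of |x|^p, and multiplying by \<open>w'_i\<close> or
  its square gives the limiting equations.

  If \<open>w'_i = 0\<close>, those two equations are trivial, but \<open>\<zeta>'_i = 0\<close>
  must be shown (\<open>smooth_abs_multiplier_vanishes\<close>). The smoothed second derivative is
  \<open>s powr (p / 2 - 1)\<close> times p(1 - (2 - p)Q), where \<open>s\<close> = x^2 + mu^2 tends
  to 0 and Q = x^2/s. For p < 1, convergence of the first derivative forces Q to 0; for p = 1 it
  makes Q tend to (dG/dw_i)^2/lambda_1^2, which differs from 1 by (A3). In both cases the second
  derivative diverges, so its product with \<open>\<zeta>_i\<close> can converge only if
  \<open>\<zeta>_i\<close> tends to 0. The limit argument is \<open>SB_KKT_limit\<close>.\<close>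

section \<open>Gradients and Hessians from uniqueness of the derivative\<close>

lemma gradient_eqI:
  assumes "GDERIV f w :> v"
  shows "gradient f w = v"
proof -
  have "frechet_derivative f (at w) = (\<lambda>h. h \<bullet> v)"
    using assms unfolding gderiv_def by (rule frechet_derivative_at[symmetric])
  then show ?thesis
    by (simp add: gradient_def vec_eq_iff inner_axis')
qed

lemma hessian_eqI:
  assumes "(gradient f has_derivative (\<lambda>h. A *v h)) (at w)"
  shows "hessian f w = A"
proof -
  have "frechet_derivative (gradient f) (at w) = (\<lambda>h. A *v h)"
    using assms by (rule frechet_derivative_at[symmetric])
  then show ?thesis
    by (simp add: hessian_def jacobian_def)
qed

lemma gradient_has_derivative_hessian:
  assumes "gradient f differentiable (at w)"
  shows "(gradient f has_derivative (\<lambda>h. hessian f w *v h)) (at w)"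
  using assms by (simp add: hessian_def jacobian_works)

lemma twice_cont_diff_continuous_gradient:
  assumes "twice_cont_diff f"
  shows "continuous_on UNIV (gradient f)"
  using assms unfolding twice_cont_diff_def
  by (simp add: continuous_at_imp_continuous_on differentiable_imp_continuous_within)

text \<open>\<open>G_fun\<close> is affine in the multipliers. In this form, joint convergence in
  the multipliers and the point reduces to limits of sums and products; the Hessian formula below
  serves the same purpose.\<close>

lemma gradient_G_fun:
  assumes "twice_cont_diff g" and "\<And>i. i \<noteq> one \<Longrightarrow> twice_cont_diff (R i)"
  shows "gradient (G_fun one g R lam) w
           = gradient g w + (\<Sum>i\<in>UNIV - {one}. lam $ i *\<^sub>R gradient (R i) w)"
proof (rule gradient_eqI)
  have g: "(g has_derivative (\<lambda>h. h \<bullet> gradient g w)) (at w)"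
    using assms(1) gderiv_gradient[of g w] by (simp add: twice_cont_diff_def gderiv_def)
  have R: "(R i has_derivative (\<lambda>h. h \<bullet> gradient (R i) w)) (at w)" if "i \<in> UNIV - {one}" for i
    using assms(2)[of i] that gderiv_gradient[of "R i" w]
    by (simp add: twice_cont_diff_def gderiv_def)
  have "((\<lambda>w. g w + (\<Sum>i\<in>UNIV - {one}. lam $ i * R i w)) has_derivative
      (\<lambda>h. h \<bullet> gradient g w + (\<Sum>i\<in>UNIV - {one}. lam $ i * (h \<bullet> gradient (R i) w)))) (at w)"
    by (intro has_derivative_add g has_derivative_sum has_derivative_mult_right R)
  then show "GDERIV (G_fun one g R lam) w :>
      gradient g w + (\<Sum>i\<in>UNIV - {one}. lam $ i *\<^sub>R gradient (R i) w)"
    unfolding gderiv_def G_fun_def[abs_def] by (simp add: inner_add_right inner_sum_right)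
qed

lemma hessian_G_fun:
  assumes "twice_cont_diff g" and "\<And>i. i \<noteq> one \<Longrightarrow> twice_cont_diff (R i)"
  shows "hessian (G_fun one g R lam) w
           = hessian g w + (\<Sum>i\<in>UNIV - {one}. lam $ i *\<^sub>R hessian (R i) w)"
proof (rule hessian_eqI)
  have g: "(gradient g has_derivative (\<lambda>h. hessian g w *v h)) (at w)"
    using assms(1) by (simp add: twice_cont_diff_def gradient_has_derivative_hessian)
  have R: "(gradient (R i) has_derivative (\<lambda>h. hessian (R i) w *v h)) (at w)"
    if "i \<in> UNIV - {one}" for i
    using assms(2)[of i] that by (simp add: twice_cont_diff_def gradient_has_derivative_hessian)
  have "((\<lambda>w. gradient g w + (\<Sum>i\<in>UNIV - {one}. lam $ i *\<^sub>R gradient (R i) w)) has_derivative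
      (\<lambda>h. hessian g w *v h + (\<Sum>i\<in>UNIV - {one}. lam $ i *\<^sub>R (hessian (R i) w *v h)))) (at w)"
    by (intro has_derivative_add g has_derivative_sum has_derivative_scaleR_right R)
  moreover have "(\<Sum>i\<in>A. B i) *v h = (\<Sum>i\<in>A. B i *v h)"
    if "finite A" for A and B :: "'b \<Rightarrow> real^'a^'a" and h
    using that by (induction A) (simp_all add: matrix_vector_mult_add_rdistrib)
  moreover have "gradient (G_fun one g R lam)
      = (\<lambda>w. gradient g w + (\<Sum>i\<in>UNIV - {one}. lam $ i *\<^sub>R gradient (R i) w))"
    using assms by (intro ext gradient_G_fun)
  ultimately show "(gradient (G_fun one g R lam) has_derivative
      (\<lambda>h. (hessian g w + (\<Sum>i\<in>UNIV - {one}. lam $ i *\<^sub>R hessian (R i) w)) *v h)) (at w)"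
    by (simp add: matrix_vector_mult_add_rdistrib scaleR_matrix_vector_assoc)
qed

section \<open>Derivatives of the smoothing function\<close>

lemma gradient_smooth_phi:
  assumes "\<mu> \<noteq> 0"
  shows "gradient (smooth_phi p \<mu>) w
           = (\<chi> i. p * w $ i * ((w $ i)\<^sup>2 + \<mu>\<^sup>2) powr (p / 2 - 1))"
proof (rule gradient_eqI)
  have pos: "(w $ i)\<^sup>2 + \<mu>\<^sup>2 > 0" for i
    using assms by (simp add: add_nonneg_pos)
  have comp: "((\<lambda>w. ((w $ i)\<^sup>2 + \<mu>\<^sup>2) powr (p / 2)) has_derivative
      (\<lambda>h. h $ i * (p * w $ i * ((w $ i)\<^sup>2 + \<mu>\<^sup>2) powr (p / 2 - 1)))) (at w)" for i
  proof -
    have "((\<lambda>x. (x\<^sup>2 + \<mu>\<^sup>2) powr (p / 2)) has_real_derivative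
        p * w $ i * ((w $ i)\<^sup>2 + \<mu>\<^sup>2) powr (p / 2 - 1)) (at (w $ i))"
      using pos[of i] by (auto intro!: derivative_eq_intros)
    from has_field_derivative_imp_has_derivative[OF this]
    have "((\<lambda>x. (x\<^sup>2 + \<mu>\<^sup>2) powr (p / 2)) \<circ> (\<lambda>w. w $ i) has_derivative
        (*) (p * w $ i * ((w $ i)\<^sup>2 + \<mu>\<^sup>2) powr (p / 2 - 1)) \<circ> (\<lambda>h. h $ i)) (at w)"
      by (intro diff_chain_at bounded_linear_imp_has_derivative bounded_linear_vec_nth)
    then show ?thesis
      by (simp add: o_def mult.commute)
  qed
  have "((\<lambda>w. \<Sum>i\<in>UNIV. ((w $ i)\<^sup>2 + \<mu>\<^sup>2) powr (p / 2)) has_derivative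
      (\<lambda>h. \<Sum>i\<in>UNIV. h $ i * (p * w $ i * ((w $ i)\<^sup>2 + \<mu>\<^sup>2) powr (p / 2 - 1)))) (at w)"
    by (intro has_derivative_sum comp)
  then show "GDERIV (smooth_phi p \<mu>) w :>
      (\<chi> i. p * w $ i * ((w $ i)\<^sup>2 + \<mu>\<^sup>2) powr (p / 2 - 1))"
    unfolding gderiv_def smooth_phi_def[abs_def] by (simp add: inner_vec_def)
qed

lemma diag_mult_vec: "(diag v *v x) $ i = v $ i * x $ i"
proof -
  have "(diag v *v x) $ i = (\<Sum>j\<in>UNIV. if j = i then v $ i * x $ i else 0)"
    unfolding diag_def matrix_vector_mult_def vec_lambda_beta by (intro sum.cong) auto
  then show ?thesis
    by simp
qed

text \<open>Each gradient component depends on its own coordinate only, so the Hessian is diagonal;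
  \<open>\<mu> \<noteq> 0\<close> keeps the base of the power positive.\<close>

lemma hessian_smooth_phi:
  assumes "\<mu> \<noteq> 0"
  shows "hessian (smooth_phi p \<mu>) w
           = diag (\<chi> i. p * ((p - 1) * (w $ i)\<^sup>2 + \<mu>\<^sup>2) * ((w $ i)\<^sup>2 + \<mu>\<^sup>2) powr (p / 2 - 2))"
proof (rule hessian_eqI)
  have pos: "(w $ i)\<^sup>2 + \<mu>\<^sup>2 > 0" for i
    using assms by (simp add: add_nonneg_pos)
  let ?d = "\<lambda>i. p * ((p - 1) * (w $ i)\<^sup>2 + \<mu>\<^sup>2) * ((w $ i)\<^sup>2 + \<mu>\<^sup>2) powr (p / 2 - 2)"
  have comp: "((\<lambda>w. p * w $ i * ((w $ i)\<^sup>2 + \<mu>\<^sup>2) powr (p / 2 - 1)) has_derivative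
      (\<lambda>h. ?d i * h $ i)) (at w)" for i
  proof -
    \<comment> \<open>The product rule yields powers with exponents \<open>p / 2 - 1\<close> and
      \<open>p / 2 - 2\<close>; pulling one factor out of the former brings both terms to a common
      power.\<close>
    have "((w $ i)\<^sup>2 + \<mu>\<^sup>2) powr (p / 2 - 1)
        = ((w $ i)\<^sup>2 + \<mu>\<^sup>2) * ((w $ i)\<^sup>2 + \<mu>\<^sup>2) powr (p / 2 - 2)"
      using pos[of i] powr_mult_base[of "(w $ i)\<^sup>2 + \<mu>\<^sup>2" "p / 2 - 2"] by simp
    then have "((\<lambda>x. p * x * (x\<^sup>2 + \<mu>\<^sup>2) powr (p / 2 - 1)) has_real_derivative ?d i) (at (w $ i))"
      using pos[of i]
      by (auto intro!: derivative_eq_intros simp: algebra_simps power2_eq_square)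
    from has_field_derivative_imp_has_derivative[OF this]
    have "((\<lambda>x. p * x * (x\<^sup>2 + \<mu>\<^sup>2) powr (p / 2 - 1)) \<circ> (\<lambda>w. w $ i) has_derivative
        (*) (?d i) \<circ> (\<lambda>h. h $ i)) (at w)"
      by (intro diff_chain_at bounded_linear_imp_has_derivative bounded_linear_vec_nth)
    then show ?thesis
      by (simp add: o_def)
  qed
  have D: "((\<lambda>w. \<chi> i. p * w $ i * ((w $ i)\<^sup>2 + \<mu>\<^sup>2) powr (p / 2 - 1)) has_derivative
      (\<lambda>h. \<chi> i. ?d i * h $ i)) (at w)"
    using comp
    by (subst has_derivative_componentwise_within) (auto simp: Basis_vec_def inner_axis)
  have diag_eq: "(*v) (diag (vec_lambda ?d)) = (\<lambda>h. \<chi> i. ?d i * h $ i)"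
    by (simp add: fun_eq_iff vec_eq_iff diag_mult_vec)
  have grad_eq: "gradient (smooth_phi p \<mu>)
      = (\<lambda>w. \<chi> i. p * w $ i * ((w $ i)\<^sup>2 + \<mu>\<^sup>2) powr (p / 2 - 1))"
    using assms by (intro ext gradient_smooth_phi)
  show "(gradient (smooth_phi p \<mu>) has_derivative (*v) (diag (vec_lambda ?d))) (at w)"
    unfolding grad_eq diag_eq by (rule D)
qed

section \<open>Error bounds for the individual equations\<close>

text \<open>A part of a tuple has at most the Euclidean norm of the tuple, so the single tolerance
  bounds every residual separately.\<close>

lemma approx_KKT_residuals:
  fixes one :: "'r::finite" and w \<zeta> :: "real^'n" and lam \<eta> :: "real^'r"
  assumes "approx_KKT one p f g R \<mu> eps w lam \<zeta> \<eta>"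
  shows "norm (gradient f w
             + (hessian (G_fun one g R lam) w + lam $ one *\<^sub>R hessian (smooth_phi p \<mu>) w) *v \<zeta>) \<le> eps"
    and "norm (gradient (smooth_phi p \<mu>) w \<bullet> \<zeta> - \<eta> $ one) \<le> eps"
    and "\<And>i. i \<noteq> one \<Longrightarrow> norm (gradient (R i) w \<bullet> \<zeta> - \<eta> $ i) \<le> eps"
    and "norm (gradient (G_fun one g R lam) w + lam $ one *\<^sub>R gradient (smooth_phi p \<mu>) w) \<le> eps"
    and "0 \<le> lam" and "0 \<le> \<eta>"
    and "norm (lam \<bullet> \<eta>) \<le> eps"
proof -
  obtain \<epsilon>1 :: "real^'n" and \<epsilon>2 :: real and \<epsilon>3 :: "real^'r" and \<epsilon>4 :: "real^'n" and \<epsilon>5 :: real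
    where e: "norm (\<epsilon>1, \<epsilon>2, \<epsilon>3, \<epsilon>4, \<epsilon>5) \<le> eps"
      and eqs: "gradient f w + (hessian (G_fun one g R lam) w
            + lam $ one *\<^sub>R hessian (smooth_phi p \<mu>) w) *v \<zeta> = \<epsilon>1"
        "gradient (smooth_phi p \<mu>) w \<bullet> \<zeta> - \<eta> $ one = \<epsilon>2"
        "\<And>i. i \<noteq> one \<Longrightarrow> gradient (R i) w \<bullet> \<zeta> - \<eta> $ i = \<epsilon>3 $ i"
        "gradient (G_fun one g R lam) w + lam $ one *\<^sub>R gradient (smooth_phi p \<mu>) w = \<epsilon>4"
        "0 \<le> lam" "0 \<le> \<eta>" "lam \<bullet> \<eta> = \<epsilon>5"
    using assms unfolding approx_KKT_def by blast
  have "norm \<epsilon>1 \<le> eps" "norm (\<epsilon>2, \<epsilon>3, \<epsilon>4, \<epsilon>5) \<le> eps"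
    using norm_fst_le[of \<epsilon>1 "(\<epsilon>2, \<epsilon>3, \<epsilon>4, \<epsilon>5)"] norm_snd_le[of "(\<epsilon>2, \<epsilon>3, \<epsilon>4, \<epsilon>5)" \<epsilon>1] e by linarith+
  moreover from this have "norm \<epsilon>2 \<le> eps" "norm (\<epsilon>3, \<epsilon>4, \<epsilon>5) \<le> eps"
    using norm_fst_le[of \<epsilon>2 "(\<epsilon>3, \<epsilon>4, \<epsilon>5)"] norm_snd_le[of "(\<epsilon>3, \<epsilon>4, \<epsilon>5)" \<epsilon>2] by linarith+
  moreover from this have "norm \<epsilon>3 \<le> eps" "norm (\<epsilon>4, \<epsilon>5) \<le> eps"
    using norm_fst_le[of \<epsilon>3 "(\<epsilon>4, \<epsilon>5)"] norm_snd_le[of "(\<epsilon>4, \<epsilon>5)" \<epsilon>3] by linarith+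
  moreover from this have "norm \<epsilon>4 \<le> eps" "norm \<epsilon>5 \<le> eps"
    using norm_fst_le[of \<epsilon>4 "\<epsilon>5"] norm_snd_le[of "\<epsilon>5" \<epsilon>4] by linarith+
  moreover have "norm (\<epsilon>3 $ i) \<le> eps" for i
    using \<open>norm \<epsilon>3 \<le> eps\<close> component_le_norm_cart[of \<epsilon>3 i] by simp
  ultimately show "norm (gradient f w
             + (hessian (G_fun one g R lam) w + lam $ one *\<^sub>R hessian (smooth_phi p \<mu>) w) *v \<zeta>) \<le> eps"
    and "norm (gradient (smooth_phi p \<mu>) w \<bullet> \<zeta> - \<eta> $ one) \<le> eps"
    and "\<And>i. i \<noteq> one \<Longrightarrow> norm (gradient (R i) w \<bullet> \<zeta> - \<eta> $ i) \<le> eps"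
    and "norm (gradient (G_fun one g R lam) w + lam $ one *\<^sub>R gradient (smooth_phi p \<mu>) w) \<le> eps"
    and "0 \<le> lam" and "0 \<le> \<eta>"
    and "norm (lam \<bullet> \<eta>) \<le> eps"
    using eqs by simp_all
qed

section \<open>Limits of the smoothed absolute power in one variable\<close>

text \<open>Away from 0 the power is continuous in its base even for a negative exponent, so the
  limit is the derivative of |x|^p at \<open>a0\<close>.\<close>

lemma smooth_abs_deriv_tendsto:
  fixes a \<mu> :: "'a \<Rightarrow> real"
  assumes "(a \<longlongrightarrow> a0) F" "(\<mu> \<longlongrightarrow> 0) F" "a0 \<noteq> 0"
  shows "((\<lambda>k. p * a k * ((a k)\<^sup>2 + (\<mu> k)\<^sup>2) powr (p / 2 - 1)) \<longlongrightarrow>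
           p * (sgn a0 * \<bar>a0\<bar> powr (p - 1))) F"
proof -
  have "((\<lambda>k. p * a k * ((a k)\<^sup>2 + (\<mu> k)\<^sup>2) powr (p / 2 - 1)) \<longlongrightarrow>
      p * a0 * (a0\<^sup>2 + 0\<^sup>2) powr (p / 2 - 1)) F"
    using assms by (intro tendsto_intros) auto
  moreover have "(a0\<^sup>2) powr (p / 2 - 1) = \<bar>a0\<bar> powr (p - 2)"
    using powr_powr[of "\<bar>a0\<bar>" 2 "p / 2 - 1"] assms(3) by (simp add: algebra_simps)
  moreover have "a0 * \<bar>a0\<bar> powr (p - 2) = sgn a0 * \<bar>a0\<bar> powr (p - 1)"
    using powr_mult_base[of "\<bar>a0\<bar>" "p - 2"] assms(3)
    by (cases "a0 > 0") (auto simp: sgn_if)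
  ultimately show ?thesis
    by (simp add: mult.assoc)
qed

text \<open>The limit is the second derivative of |x|^p at \<open>a0\<close>, written as a quotient
  so that multiplication by \<open>a0\<^sup>2\<close> produces the diagonal term of
  \<open>H_mat\<close>.\<close>

lemma smooth_abs_second_deriv_tendsto:
  fixes a \<mu> :: "'a \<Rightarrow> real"
  assumes "(a \<longlongrightarrow> a0) F" "(\<mu> \<longlongrightarrow> 0) F" "a0 \<noteq> 0"
  shows "((\<lambda>k. p * ((p - 1) * (a k)\<^sup>2 + (\<mu> k)\<^sup>2) * ((a k)\<^sup>2 + (\<mu> k)\<^sup>2) powr (p / 2 - 2)) \<longlongrightarrow>
           p * (p - 1) * \<bar>a0\<bar> powr p / a0\<^sup>2) F"
proof -
  have "((\<lambda>k. p * ((p - 1) * (a k)\<^sup>2 + (\<mu> k)\<^sup>2) * ((a k)\<^sup>2 + (\<mu> k)\<^sup>2) powr (p / 2 - 2)) \<longlongrightarrow>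
      p * ((p - 1) * a0\<^sup>2 + 0\<^sup>2) * (a0\<^sup>2 + 0\<^sup>2) powr (p / 2 - 2)) F"
    using assms by (intro tendsto_intros) auto
  moreover have "(a0\<^sup>2) powr (p / 2 - 2) = \<bar>a0\<bar> powr p / a0 ^ 4"
    using powr_powr[of "\<bar>a0\<bar>" 2 "p / 2 - 2"] powr_diff[of "\<bar>a0\<bar>" p 4] assms(3)
    by (simp add: algebra_simps)
  ultimately have "((\<lambda>k. p * ((p - 1) * (a k)\<^sup>2 + (\<mu> k)\<^sup>2) * ((a k)\<^sup>2 + (\<mu> k)\<^sup>2) powr (p / 2 - 2))
      \<longlongrightarrow> p * ((p - 1) * a0\<^sup>2) * (\<bar>a0\<bar> powr p / a0 ^ 4)) F"
    by simp
  moreover have "p * ((p - 1) * a0\<^sup>2) * (\<bar>a0\<bar> powr p / a0 ^ 4) = p * (p - 1) * \<bar>a0\<bar> powr p / a0\<^sup>2"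
    using assms(3) by (simp add: divide_simps power2_eq_square power4_eq_xxxx)
  ultimately show ?thesis
    by simp
qed

text \<open>With \<open>s = a\<^sup>2 + \<mu>\<^sup>2\<close>, \<open>Q = a\<^sup>2 / s\<close> and \<open>v\<close> the first derivative of \<open>s powr (p / 2)\<close> in \<open>a\<close>,
  one has \<open>Q = (v / p)\<^sup>2 * s powr (1 - p)\<close>, while the second derivative times \<open>s powr (1 - p / 2)\<close>
  is \<open>p * (1 - (2 - p) * Q)\<close>. As \<open>v\<close> converges, the limit of the latter is nonzero, so the
  second derivative blows up and forces \<open>z\<close> to vanish in the limit.\<close>

lemma smooth_abs_multiplier_vanishes:
  fixes a \<mu> z :: "'a \<Rightarrow> real"
  assumes p: "0 < p" "p \<le> 1" and F: "F \<noteq> bot"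
    and a: "(a \<longlongrightarrow> 0) F" and mu: "(\<mu> \<longlongrightarrow> 0) F" "\<And>k. \<mu> k \<noteq> 0"
    and v: "((\<lambda>k. p * a k * ((a k)\<^sup>2 + (\<mu> k)\<^sup>2) powr (p / 2 - 1)) \<longlongrightarrow> v0) F"
    and v0: "p = 1 \<Longrightarrow> \<bar>v0\<bar> \<noteq> 1"
    and m: "((\<lambda>k. p * ((p - 1) * (a k)\<^sup>2 + (\<mu> k)\<^sup>2)
               * ((a k)\<^sup>2 + (\<mu> k)\<^sup>2) powr (p / 2 - 2) * z k) \<longlongrightarrow> m0) F"
    and z: "(z \<longlongrightarrow> z0) F"
  shows "z0 = 0"
proof -
  define s where "s k = (a k)\<^sup>2 + (\<mu> k)\<^sup>2" for k
  define Q where "Q k = (a k)\<^sup>2 / s k" for k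
  have spos: "s k > 0" for k
    using mu(2)[of k] by (simp add: s_def add_nonneg_pos)
  have s0: "(s \<longlongrightarrow> 0) F"
    unfolding s_def[abs_def] using tendsto_add[OF tendsto_power[OF a, of 2] tendsto_power[OF mu(1), of 2]]
    by simp
  have s_powr: "((\<lambda>k. s k powr e) \<longlongrightarrow> 0) F" if "e > 0" for e
    using tendsto_powr'[OF s0 tendsto_const, of e] spos that by (simp add: less_imp_le)
  have Q_eq: "Q k = (p * a k * s k powr (p / 2 - 1))\<^sup>2 / p\<^sup>2 * s k powr (1 - p)" for k
  proof -
    have "(s k powr (p / 2 - 1))\<^sup>2 * s k powr (1 - p) = s k powr (- 1)"
      by (simp add: power2_eq_square powr_add[symmetric])
    then show ?thesis
      using p(1) spos[of k] by (simp add: Q_def power_mult_distrib powr_minus_divide mult.assoc)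
  qed
  \<comment> \<open>For p = 1 the factor \<open>s powr (1 - p)\<close> is 1, so \<open>Q0\<close> is
    \<open>v0\<^sup>2\<close> and differs from 1 by \<open>v0\<close>. For p < 1 that factor tends
    to 0, so \<open>Q0\<close> is 0.\<close>
  obtain Q0 where Q0: "(Q \<longlongrightarrow> Q0) F" "1 - (2 - p) * Q0 \<noteq> 0"
  proof (cases "p = 1")
    case True
    have "Q = (\<lambda>k. (p * a k * s k powr (p / 2 - 1))\<^sup>2)"
      unfolding Q_eq[abs_def] using True spos by (simp add: less_imp_neq[symmetric])
    then have "(Q \<longlongrightarrow> v0\<^sup>2) F"
      using tendsto_power[OF v, of 2] by (simp only: s_def)
    moreover have "1 - (2 - p) * v0\<^sup>2 \<noteq> 0"
      using v0 True by (simp add: abs_square_eq_1)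
    ultimately show ?thesis
      using that by blast
  next
    case False
    have "((\<lambda>k. (p * a k * s k powr (p / 2 - 1))\<^sup>2 / p\<^sup>2 * s k powr (1 - p)) \<longlongrightarrow> v0\<^sup>2 / p\<^sup>2 * 0) F"
      using p False by (intro tendsto_mult tendsto_divide tendsto_power tendsto_const s_powr)
        (use v in \<open>simp_all add: s_def\<close>)
    then show ?thesis
      using that[of 0] by (simp add: Q_eq[abs_def])
  qed
  let ?d = "\<lambda>k. p * ((p - 1) * (a k)\<^sup>2 + (\<mu> k)\<^sup>2) * s k powr (p / 2 - 2)"
  have eq: "?d k * z k * s k powr (1 - p / 2) = p * (1 - (2 - p) * Q k) * z k" for k
  proof -
    have pw: "s k powr (p / 2 - 2) * s k powr (1 - p / 2) = 1 / s k"
      using spos[of k] by (simp add: powr_add[symmetric] powr_minus_divide)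
    have Q: "1 - (2 - p) * Q k = ((p - 1) * (a k)\<^sup>2 + (\<mu> k)\<^sup>2) * (1 / s k)"
      using spos[of k] by (simp add: Q_def field_simps) (simp add: s_def algebra_simps)
    show ?thesis
      unfolding Q pw[symmetric] by (simp only: ac_simps)
  qed
  \<comment> \<open>The same sequence has two limits: one through \<open>Q\<close>, and 0 because
    \<open>?d k * z k\<close> converges while the power of \<open>s\<close> has a positive exponent
    and vanishes.\<close>
  have "((\<lambda>k. ?d k * z k * s k powr (1 - p / 2)) \<longlongrightarrow> p * (1 - (2 - p) * Q0) * z0) F"
    unfolding eq by (intro tendsto_intros Q0 z)
  moreover have "((\<lambda>k. ?d k * z k * s k powr (1 - p / 2)) \<longlongrightarrow> m0 * 0) F"
    using p by (intro tendsto_mult s_powr m[folded s_def]) simp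
  ultimately have "p * (1 - (2 - p) * Q0) * z0 = m0 * 0"
    by (rule tendsto_unique[OF F])
  then show ?thesis
    using p(1) Q0(2) by simp
qed

section \<open>Passage to the limit in the approximate KKT system\<close>

text \<open>Separates the analysis from the choice of subsequence: all sequences converge, and (A1)
  and (A3) enter only as statements about the limit.\<close>

lemma SB_KKT_limit:
  fixes one :: "'r::finite" and w \<zeta> :: "nat \<Rightarrow> real^'n" and lam \<eta> :: "nat \<Rightarrow> real^'r"
  assumes p: "0 < p" "p \<le> 1"
    and f: "cont_diff f" and g: "twice_cont_diff g" and R: "\<And>i. i \<noteq> one \<Longrightarrow> twice_cont_diff (R i)"
    and KKT: "\<And>k. approx_KKT one p f g R (\<mu> k) (eps k) (w k) (lam k) (\<zeta> k) (\<eta> k)"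
    and mu: "\<And>k. \<mu> k \<noteq> 0" "\<mu> \<longlonglongrightarrow> 0" and eps: "eps \<longlonglongrightarrow> 0"
    and w: "w \<longlonglongrightarrow> w'" and lam: "lam \<longlonglongrightarrow> lam'" and \<zeta>: "\<zeta> \<longlonglongrightarrow> \<zeta>'" and \<eta>: "\<eta> \<longlonglongrightarrow> \<eta>'"
    and lam1: "lam' $ one > 0"
    and A3: "\<And>i. p = 1 \<Longrightarrow> i \<in> zero_set w' \<Longrightarrow> lam' $ one \<noteq> \<bar>gradient (G_fun one g R lam') w' $ i\<bar>"
  shows "SB_KKT one p f g R w' lam' \<zeta>' \<eta>'"
proof -
  note residuals = KKT[THEN approx_KKT_residuals(1)] KKT[THEN approx_KKT_residuals(2)]
    KKT[THEN approx_KKT_residuals(3)] KKT[THEN approx_KKT_residuals(4)]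
    KKT[THEN approx_KKT_residuals(7)]
  note null = Lim_null_comparison[OF _ eps, OF always_eventually, OF allI]
  have comp: "(\<lambda>k. X k $ i) \<longlonglongrightarrow> x $ i" if "X \<longlonglongrightarrow> x" for X x and i :: "'a::finite"
    using that by (rule tendsto_vec_nth)
  have cont: "(\<lambda>k. F (w k)) \<longlonglongrightarrow> F w'" if "continuous_on UNIV F" for F :: "real^'n \<Rightarrow> 'b::topological_space"
    using continuous_on_tendsto_compose[OF that w] by simp
  have gradR: "(\<lambda>k. gradient (R i) (w k)) \<longlonglongrightarrow> gradient (R i) w'" if "i \<noteq> one" for i
    by (intro cont twice_cont_diff_continuous_gradient R that)
  have hessR: "(\<lambda>k. hessian (R i) (w k)) \<longlonglongrightarrow> hessian (R i) w'" if "i \<noteq> one" for i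
    using R[OF that] by (intro cont) (simp add: twice_cont_diff_def)
  let ?G = "\<lambda>k. gradient (G_fun one g R (lam k)) (w k)"
  let ?G' = "gradient (G_fun one g R lam') w'"
  let ?A = "\<lambda>k. hessian (G_fun one g R (lam k)) (w k)"
  let ?A' = "hessian (G_fun one g R lam') w'"
  have gradG: "gradient (G_fun one g R l) x
      = gradient g x + (\<Sum>i\<in>UNIV - {one}. l $ i *\<^sub>R gradient (R i) x)" for l x
    by (intro gradient_G_fun g R)
  have hessG: "hessian (G_fun one g R l) x
      = hessian g x + (\<Sum>i\<in>UNIV - {one}. l $ i *\<^sub>R hessian (R i) x)" for l x
    by (intro hessian_G_fun g R)
  have G: "?G \<longlonglongrightarrow> ?G'"
    unfolding gradG using g
    by (intro tendsto_add tendsto_sum tendsto_scaleR comp lam gradR cont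
        twice_cont_diff_continuous_gradient) auto
  have A: "?A \<longlonglongrightarrow> ?A'"
    unfolding hessG using g
    by (intro tendsto_add tendsto_sum tendsto_scaleR comp lam hessR cont)
      (auto simp: twice_cont_diff_def)
  define a where "a i k = p * w k $ i * ((w k $ i)\<^sup>2 + (\<mu> k)\<^sup>2) powr (p / 2 - 1)" for i k
  define d where "d i k = p * ((p - 1) * (w k $ i)\<^sup>2 + (\<mu> k)\<^sup>2)
      * ((w k $ i)\<^sup>2 + (\<mu> k)\<^sup>2) powr (p / 2 - 2)" for i k
  have phi_grad: "gradient (smooth_phi p (\<mu> k)) (w k) = (\<chi> i. a i k)" for k
    by (simp add: gradient_smooth_phi[OF mu(1)] a_def)
  have phi_hess: "hessian (smooth_phi p (\<mu> k)) (w k) = diag (\<chi> i. d i k)" for k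
    by (simp add: hessian_smooth_phi[OF mu(1)] d_def)
  have "(\<lambda>k. gradient f (w k) + (?A k + lam k $ one *\<^sub>R diag (\<chi> i. d i k)) *v \<zeta> k) \<longlonglongrightarrow> 0"
    using residuals(1) by (intro null) (simp add: phi_hess)
  from comp[OF this]
  have e1: "(\<lambda>k. gradient f (w k) $ i + (?A k *v \<zeta> k) $ i + lam k $ one * (d i k * \<zeta> k $ i)) \<longlonglongrightarrow> 0" for i
    by (simp add: matrix_vector_mult_add_rdistrib scaleR_matrix_vector_assoc[symmetric]
        diag_mult_vec add.assoc)
  have "(\<lambda>k. ?G k + lam k $ one *\<^sub>R (\<chi> i. a i k)) \<longlonglongrightarrow> 0"
    using residuals(4) by (intro null) (simp add: phi_grad)
  from comp[OF this] have e4: "(\<lambda>k. ?G k $ i + lam k $ one * a i k) \<longlonglongrightarrow> 0" for i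
    by simp
  have e2: "(\<lambda>k. (\<chi> i. a i k) \<bullet> \<zeta> k - \<eta> k $ one) \<longlonglongrightarrow> 0"
    using residuals(2) by (intro null) (simp add: phi_grad)
  \<comment> \<open>Early multipliers may vanish, so cancelling lambda_1 is justified only for large
    \<open>k\<close>.\<close>
  have lam_ne: "eventually (\<lambda>k. lam k $ one \<noteq> 0) sequentially"
    using tendsto_imp_eventually_ne[OF comp[OF lam]] lam1 by simp
  have quotient: "X \<longlonglongrightarrow> x / lam' $ one" if "(\<lambda>k. lam k $ one * X k) \<longlonglongrightarrow> x" for X x
  proof -
    have "(\<lambda>k. lam k $ one * X k / lam k $ one) \<longlonglongrightarrow> x / lam' $ one"
      using lam1 by (intro tendsto_divide that comp lam) simp
    then show ?thesis
      by (rule Lim_transform_eventually) (use lam_ne in \<open>auto elim: eventually_mono\<close>)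
  qed
  \<comment> \<open>This holds for every \<open>i\<close>, including those with
    \<open>w' $ i = 0\<close>, where the formula for the derivative alone gives no limit.\<close>
  have a_lim: "a i \<longlonglongrightarrow> - ?G' $ i / lam' $ one" for i
    using tendsto_diff[OF e4[of i] comp[OF G, of i]] by (intro quotient) simp
  have f_lim: "(\<lambda>k. gradient f (w k)) \<longlonglongrightarrow> gradient f w'"
    using f by (intro cont) (simp add: cont_diff_def)
  have A_lim: "(\<lambda>k. ?A k *v \<zeta> k) \<longlonglongrightarrow> ?A' *v \<zeta>'"
    unfolding matrix_vector_mult_def by (intro tendsto_intros comp A \<zeta>)
  have ld_lim: "(\<lambda>k. lam k $ one * (d i k * \<zeta> k $ i)) \<longlonglongrightarrow> - (gradient f w' $ i + (?A' *v \<zeta>') $ i)" for i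
    using tendsto_diff[OF e1[of i] tendsto_add[OF comp[OF f_lim, of i] comp[OF A_lim, of i]]] by simp
  note dz_lim = quotient[OF ld_lim]
  have zero: "\<zeta>' $ i = 0" if i: "i \<in> zero_set w'" for i
  proof (rule smooth_abs_multiplier_vanishes[OF p sequentially_bot _ mu(2,1)])
    show "(\<lambda>k. w k $ i) \<longlonglongrightarrow> 0"
      using comp[OF w, of i] i by (simp add: zero_set_def)
    show "(\<lambda>k. p * w k $ i * ((w k $ i)\<^sup>2 + (\<mu> k)\<^sup>2) powr (p / 2 - 1)) \<longlonglongrightarrow> - ?G' $ i / lam' $ one"
      using a_lim[of i] by (simp add: a_def[abs_def])
    \<comment> \<open>This is (A3) at the limit point, divided by the positive number
      \<open>lam' $ one\<close>.\<close>
    show "\<bar>- ?G' $ i / lam' $ one\<bar> \<noteq> 1" if "p = 1"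
      using A3[OF that i] lam1 by (auto simp: abs_divide)
    show "(\<lambda>k. p * ((p - 1) * (w k $ i)\<^sup>2 + (\<mu> k)\<^sup>2) * ((w k $ i)\<^sup>2 + (\<mu> k)\<^sup>2) powr (p / 2 - 2)
        * \<zeta> k $ i) \<longlonglongrightarrow> - (gradient f w' $ i + (?A' *v \<zeta>') $ i) / lam' $ one"
      using dz_lim[of i] by (simp add: d_def[abs_def])
    show "(\<lambda>k. \<zeta> k $ i) \<longlonglongrightarrow> \<zeta>' $ i"
      by (rule comp[OF \<zeta>])
  qed
  have a_lim': "a i \<longlonglongrightarrow> p * (sgn (w' $ i) * \<bar>w' $ i\<bar> powr (p - 1))" if "w' $ i \<noteq> 0" for i
    unfolding a_def[abs_def] by (rule smooth_abs_deriv_tendsto[OF comp[OF w] mu(2) that])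
  have d_lim': "d i \<longlonglongrightarrow> p * (p - 1) * \<bar>w' $ i\<bar> powr p / (w' $ i)\<^sup>2" if "w' $ i \<noteq> 0" for i
    unfolding d_def[abs_def] by (rule smooth_abs_second_deriv_tendsto[OF comp[OF w] mu(2) that])

  have "(diag w' ** diag w') *v gradient f w' + H_mat one p g R w' lam' *v \<zeta>' = 0"
  proof (subst vec_eq_iff, intro allI)
    fix i
    have "(w' $ i)\<^sup>2 * (gradient f w' $ i + (?A' *v \<zeta>') $ i)
        + lam' $ one * p * (p - 1) * (\<bar>w' $ i\<bar> powr p * \<zeta>' $ i) = 0"
    proof (cases "w' $ i = 0")
      case True
      then show ?thesis using p by simp
    next
      case False
      have d_lim: "(\<lambda>k. lam k $ one * (d i k * \<zeta> k $ i)) \<longlonglongrightarrow>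
          lam' $ one * (p * (p - 1) * \<bar>w' $ i\<bar> powr p / (w' $ i)\<^sup>2 * \<zeta>' $ i)"
        by (intro tendsto_mult comp lam d_lim' \<zeta> False)
      \<comment> \<open>The limit computed from the second derivative must agree with the one
        dictated by the first residual; the factor \<open>(w' $ i)\<^sup>2\<close> clears the
        denominator.\<close>
      have "(w' $ i)\<^sup>2 * (lam' $ one * (p * (p - 1) * \<bar>w' $ i\<bar> powr p / (w' $ i)\<^sup>2 * \<zeta>' $ i))
          = - ((w' $ i)\<^sup>2 * (gradient f w' $ i + (?A' *v \<zeta>') $ i))"
        by (subst LIMSEQ_unique[OF d_lim ld_lim[of i]]) (rule mult_minus_right)
      moreover have "(w' $ i)\<^sup>2 * (lam' $ one * (p * (p - 1) * \<bar>w' $ i\<bar> powr p / (w' $ i)\<^sup>2 * \<zeta>' $ i))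
          = lam' $ one * p * (p - 1) * (\<bar>w' $ i\<bar> powr p * \<zeta>' $ i)"
        using False by simp
      ultimately show ?thesis
        by simp
    qed
    then show "((diag w' ** diag w') *v gradient f w' + H_mat one p g R w' lam' *v \<zeta>') $ i = 0 $ i"
      by (simp add: H_mat_def matrix_vector_mult_add_rdistrib scaleR_matrix_vector_assoc[symmetric]
          matrix_vector_mul_assoc[symmetric] diag_mult_vec abs_powr_def algebra_simps power2_eq_square)
  qed
  moreover have "diag w' *v ?G' + (p * lam' $ one) *\<^sub>R abs_powr w' p = 0"
  proof (subst vec_eq_iff, intro allI)
    fix i
    have "w' $ i * ?G' $ i + p * lam' $ one * \<bar>w' $ i\<bar> powr p = 0"
    proof (cases "w' $ i = 0")
      case True
      then show ?thesis using p by simp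
    next
      case False
      have "?G' $ i = - (lam' $ one * (p * (sgn (w' $ i) * \<bar>w' $ i\<bar> powr (p - 1))))"
        using LIMSEQ_unique[OF a_lim a_lim'[OF False]] lam1 by (simp add: field_simps)
      moreover have "w' $ i * (sgn (w' $ i) * \<bar>w' $ i\<bar> powr (p - 1)) = \<bar>w' $ i\<bar> powr p"
        using powr_mult_base[of "\<bar>w' $ i\<bar>" "p - 1"] False
        by (cases "w' $ i > 0") (auto simp: sgn_if)
      ultimately show ?thesis
        by (simp add: mult.left_commute)
    qed
    then show "(diag w' *v ?G' + (p * lam' $ one) *\<^sub>R abs_powr w' p) $ i = 0 $ i"
      by (simp add: diag_mult_vec abs_powr_def)
  qed
  moreover have "p * (\<Sum>i\<in>UNIV - zero_set w'. sgn (w' $ i) * \<bar>w' $ i\<bar> powr (p - 1) * \<zeta>' $ i) = \<eta>' $ one"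
  proof -
    let ?L = "\<lambda>i. p * (sgn (w' $ i) * \<bar>w' $ i\<bar> powr (p - 1)) * \<zeta>' $ i"
    have "(\<lambda>k. a i k * \<zeta> k $ i) \<longlonglongrightarrow> ?L i" for i
    proof (cases "w' $ i = 0")
      \<comment> \<open>Here \<open>a i\<close> need not tend to 0, but it converges, and
        \<open>\<zeta>' $ i = 0\<close> makes the product vanish in the limit.\<close>
      case True
      then have "\<zeta>' $ i = 0"
        by (intro zero) (simp add: zero_set_def)
      then show ?thesis
        using tendsto_mult[OF a_lim[of i] comp[OF \<zeta>, of i]] by simp
    qed (intro tendsto_mult a_lim' comp \<zeta>)
    then have "(\<lambda>k. (\<chi> i. a i k) \<bullet> \<zeta> k) \<longlonglongrightarrow> (\<Sum>i\<in>UNIV. ?L i)"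
      unfolding inner_vec_def by (intro tendsto_sum) simp
    from LIMSEQ_unique[OF tendsto_diff[OF this comp[OF \<eta>]] e2]
    have "\<eta>' $ one = (\<Sum>i\<in>UNIV. ?L i)"
      by simp
    also have "\<dots> = (\<Sum>i\<in>UNIV - zero_set w'. ?L i)"
      by (intro sum.mono_neutral_right) (auto simp: zero)
    finally show ?thesis
      by (simp add: sum_distrib_left mult.assoc)
  qed
  moreover have "gradient (R i) w' \<bullet> \<zeta>' = \<eta>' $ i" if "i \<noteq> one" for i
  proof -
    have "(\<lambda>k. gradient (R i) (w k) \<bullet> \<zeta> k - \<eta> k $ i) \<longlonglongrightarrow> gradient (R i) w' \<bullet> \<zeta>' - \<eta>' $ i"
      by (intro tendsto_diff tendsto_inner gradR that \<zeta> comp \<eta>)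
    moreover have "(\<lambda>k. gradient (R i) (w k) \<bullet> \<zeta> k - \<eta> k $ i) \<longlonglongrightarrow> 0"
      using residuals(3)[OF that] by (rule null)
    ultimately show ?thesis
      using LIMSEQ_unique by fastforce
  qed
  moreover have "0 \<le> x" if "X \<longlonglongrightarrow> x" "\<And>k. 0 \<le> X k" for X and x :: "real^'r"
    using tendsto_lowerbound[OF comp[OF that(1)], of 0] that(2) by (simp add: less_eq_vec_def)
  then have "0 \<le> lam'" "0 \<le> \<eta>'"
    using lam \<eta> KKT[THEN approx_KKT_residuals(5)] KKT[THEN approx_KKT_residuals(6)] by blast+
  moreover have "lam' \<bullet> \<eta>' = 0"
    using LIMSEQ_unique[OF tendsto_inner[OF lam \<eta>]] null[OF residuals(5)] by blast
  ultimately show ?thesis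
    using zero unfolding SB_KKT_def by blast
qed

section \<open>Reduction of the algorithm to a convergent subsequence\<close>

theorem theorem5:
  fixes one :: "'r::finite"
    and p :: real
    and f g :: "real^'n \<Rightarrow> real"
    and R :: "'r \<Rightarrow> real^'n \<Rightarrow> real"
    and w \<zeta> :: "nat \<Rightarrow> real^'n"
    and lam \<eta> :: "nat \<Rightarrow> real^'r"
    and w' \<zeta>' :: "real^'n"
    and lam' \<eta>' :: "real^'r"
  assumes "0 < p" and "p \<le> 1"
    and "cont_diff f"
    and "twice_cont_diff g"
    and "\<And>i. i \<noteq> one \<Longrightarrow> twice_cont_diff (R i)"
    and "generated_by_smoothing one p f g R w lam \<zeta> \<eta>"
    and A1: "liminf (\<lambda>k. ereal (lam k $ one)) > 0"
    and A2: "bounded ((\<lambda>k. (w k, lam k, \<zeta> k, \<eta> k)) ` {1..})"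
    and A3: "\<And>ws lams i. p = 1 \<Longrightarrow> accumulation_point (\<lambda>k. (w k, lam k)) (ws, lams) \<Longrightarrow>
               i \<in> zero_set ws \<Longrightarrow> lams $ one \<noteq> \<bar>gradient (G_fun one g R lams) ws $ i\<bar>"
    and "accumulation_point (\<lambda>k. (w k, lam k, \<zeta> k, \<eta> k)) (w', lam', \<zeta>', \<eta>')"
  shows "SB_KKT one p f g R w' lam' \<zeta>' \<eta>'"
proof -
  obtain \<mu> eps :: "nat \<Rightarrow> real" and \<beta>1 \<beta>2 :: real
    where mu0: "\<mu> 0 \<noteq> 0" and \<beta>: "0 < \<beta>1" "\<beta>1 < 1" "0 < \<beta>2" "\<beta>2 < 1"
      and KKT: "\<And>k. approx_KKT one p f g R (\<mu> k) (eps k)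
          (w (Suc k)) (lam (Suc k)) (\<zeta> (Suc k)) (\<eta> (Suc k))"
      and mu_Suc: "\<And>k. \<mu> (Suc k) = \<beta>1 * \<mu> k" and eps_Suc: "\<And>k. eps (Suc k) = \<beta>2 * eps k"
    using \<open>generated_by_smoothing one p f g R w lam \<zeta> \<eta>\<close>
    unfolding generated_by_smoothing_def by blast
  have mu: "\<mu> k = \<mu> 0 * \<beta>1 ^ k" and eps: "eps k = eps 0 * \<beta>2 ^ k" for k
    by (induction k) (simp_all add: mu_Suc eps_Suc)
  have mu_lim: "\<mu> \<longlonglongrightarrow> 0" and eps_lim: "eps \<longlonglongrightarrow> 0"
    using \<beta> tendsto_mult_right_zero[OF LIMSEQ_realpow_zero[of \<beta>1], of "\<mu> 0"]
      tendsto_mult_right_zero[OF LIMSEQ_realpow_zero[of \<beta>2], of "eps 0"]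
    by (simp_all flip: mu eps)
  have mu_ne: "\<mu> k \<noteq> 0" for k
    using mu0 \<beta> mu[of k] by simp
  obtain s where s: "strict_mono s"
    and s_lim: "(\<lambda>k. (w (s k), lam (s k), \<zeta> (s k), \<eta> (s k))) \<longlonglongrightarrow> (w', lam', \<zeta>', \<eta>')"
    using \<open>accumulation_point (\<lambda>k. (w k, lam k, \<zeta> k, \<eta> k)) _\<close>
    unfolding accumulation_point_def o_def by blast
  have lims: "(\<lambda>k. w (s k)) \<longlonglongrightarrow> w'" "(\<lambda>k. lam (s k)) \<longlonglongrightarrow> lam'"
    "(\<lambda>k. \<zeta> (s k)) \<longlonglongrightarrow> \<zeta>'" "(\<lambda>k. \<eta> (s k)) \<longlonglongrightarrow> \<eta>'"
    using tendsto_fst[OF s_lim] tendsto_fst[OF tendsto_snd[OF s_lim]]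
      tendsto_fst[OF tendsto_snd[OF tendsto_snd[OF s_lim]]]
      tendsto_snd[OF tendsto_snd[OF tendsto_snd[OF s_lim]]] by simp_all
  \<comment> \<open>Iterate \<open>Suc k\<close> is computed with the parameters of index
    \<open>k\<close>. Since \<open>s 0\<close> may be 0, where the iterate is unconstrained, the
    first term is dropped; \<open>s (Suc k)\<close> is at least 1 and has a true
    predecessor.\<close>
  define t where "t k = s (Suc k) - 1" for k
  have Suc_t: "Suc (t k) = s (Suc k)" for k
    using strict_mono_imp_increasing[OF s, of "Suc k"] by (simp add: t_def)
  have t: "strict_mono t"
    using s by (intro strict_monoI_Suc) (metis Suc_less_eq Suc_t strict_mono_Suc_iff)
  have lam1: "lam' $ one > 0"
  proof -
    have "(\<lambda>k. ereal (lam (s k) $ one)) \<longlonglongrightarrow> ereal (lam' $ one)"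
      by (intro tendsto_ereal tendsto_vec_nth lims)
    then have "liminf ((\<lambda>k. ereal (lam k $ one)) \<circ> s) = ereal (lam' $ one)"
      by (simp add: o_def lim_imp_Liminf)
    \<comment> \<open>The lower limit can only grow when passing to a subsequence, so (A1) bounds
      the limit away from 0.\<close>
    then have "0 < ereal (lam' $ one)"
      using A1 liminf_subseq_mono[OF s, of "\<lambda>k. ereal (lam k $ one)"] by (metis less_le_trans)
    then show ?thesis
      by simp
  qed
  \<comment> \<open>Projecting the same subsequence to two of its components makes (A3) applicable
    at the limit.\<close>
  have acc: "accumulation_point (\<lambda>k. (w k, lam k)) (w', lam')"
    unfolding accumulation_point_def o_def using s tendsto_Pair[OF lims(1,2)] by blast
  have ne: "lam' $ one \<noteq> \<bar>gradient (G_fun one g R lam') w' $ i\<bar>"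
    if "p = 1" "i \<in> zero_set w'" for i
    using A3[OF that(1) acc that(2)] .
  have null: "(\<lambda>k. \<mu> (t k)) \<longlonglongrightarrow> 0" "(\<lambda>k. eps (t k)) \<longlonglongrightarrow> 0"
    using LIMSEQ_subseq_LIMSEQ[OF mu_lim t] LIMSEQ_subseq_LIMSEQ[OF eps_lim t]
    by (simp_all add: o_def)
  show ?thesis
    by (rule SB_KKT_limit[where \<mu> = "\<lambda>k. \<mu> (t k)" and eps = "\<lambda>k. eps (t k)"
          and w = "\<lambda>k. w (Suc (t k))" and lam = "\<lambda>k. lam (Suc (t k))"
          and \<zeta> = "\<lambda>k. \<zeta> (Suc (t k))" and \<eta> = "\<lambda>k. \<eta> (Suc (t k))"])
      (fact assms(1-5) KKT mu_ne null lims[THEN LIMSEQ_Suc, folded Suc_t] lam1 ne)+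
qed

end
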